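(* Let $\mathfrak{g}$ be a Lie algebra and let $\mathfrak{b}\subseteq \mathrm{Der}(\mathfrak{g})$ be a torus on $\mathfrak{g}$ such that $(\mathfrak{g},\mathfrak{b})$ is a non-degenerate pair. Let $\tau=\{t\in \mathrm{Der}(\mathfrak{g}) : [t,b]=0 \ \forall\, b\in\mathfrak{b}\}$ be the commutator of $\mathfrak{b}$ in $\mathrm{Der}(\mathfrak{g})$. Let $\mathfrak{h}=\tau\times_{t}\mathfrak{g}$ and $\mathfrak{h}_{1}=\mathfrak{b}\times_{t}\mathfrak{g}$. Then $\mathfrak{h}=\mathrm{Der}(\mathfrak{h}_{1})$ (that is, the homomorphism $\mathfrak{h}\to\mathrm{Der}(\mathfrak{h}_1)$, $(t_0,g_0)\mapsto D_{(t_0,g_0)}$, with $D_{(t_0,g_0)}(b,g)=(0,\,t_0(g)-b(g_0)+[g_0,g])$, is an isomorphism of Lie algebras), and $\mathfrak{h}$ is a complete Lie algebra.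
   Context: All Lie algebras are finite dimensional over a field $K$ of characteristic $0$. $\mathrm{Der}(\mathfrak{g})$ is the derivation algebra of $\mathfrak{g}$. A Lie algebra is complete if its center is trivial and all its derivations are inner. A torus on $\mathfrak{g}$ is a commutative Lie subalgebra $\mathfrak{b}$ of $\mathrm{Der}(\mathfrak{g})$ all of whose elements are semisimple. For $\alpha\in\mathfrak{b}^*$ put $\mathfrak{g}_\alpha=\{g\in\mathfrak{g}: D(g)=\alpha(D)g\ \forall D\in\mathfrak{b}\}$, and let $\Delta=\{\alpha\in\mathfrak{b}^*:\mathfrak{g}_\alpha\neq 0\}$. It is understood that $\mathfrak{g}=\bigoplus_{\alpha\in\Delta}\mathfrak{g}_\alpha$ (automatic if $K$ is algebraically closed). The pair $(\mathfrak{g},\mathfrak{b})$ is non-degenerate if every $\alpha\in\Delta$ is nonzero. For a Lie subalgebra $\mathfrak{s}\subseteq\mathrm{Der}(\mathfrak{g})$, $\mathfrak{s}\times_t\mathfrak{g}$ denotes the semidirect product: the vector space $\mathfrak{s}\oplus\mathfrak{g}$ with bracket $[(s_1,g_1),(s_2,g_2)]=([s_1,s_2],\,s_1(g_2)-s_2(g_1)+[g_1,g_2])$. *)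

theory Defs
  imports Complex_Main "HOL-Library.Function_Algebras" "HOL-Library.Product_Plus"
begin

text \<open>A Lie algebra is carried by a subspace of an ambient vector space (a whole type). The ambient
  space need not be finite dimensional, and the bracket is only constrained on the carrier.
  Maps and functionals defined on a carrier are represented by functions that vanish outside it,
  so that equality and the pointwise operations on functions are those of maps on the carrier.\<close>

record ('k, 'a) lie_alg =
  carrier :: "'a set"
  scale :: "'k \<Rightarrow> 'a \<Rightarrow> 'a"
  bracket :: "'a \<Rightarrow> 'a \<Rightarrow> 'a"

locale lie_algebra = vector_space "scale G"
  for G :: "('k::field, 'a::ab_group_add) lie_alg" +
  assumes subspace_carrier: "subspace (carrier G)"
    and finite_dimensional: "\<exists>S. finite S \<and> span S = carrier G"
    and bracket_closed: "\<lbrakk>x \<in> carrier G; y \<in> carrier G\<rbrakk> \<Longrightarrow> bracket G x y \<in> carrier G"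
    and bracket_add_left: "\<lbrakk>x \<in> carrier G; y \<in> carrier G; z \<in> carrier G\<rbrakk>
      \<Longrightarrow> bracket G (x + y) z = bracket G x z + bracket G y z"
    and bracket_add_right: "\<lbrakk>x \<in> carrier G; y \<in> carrier G; z \<in> carrier G\<rbrakk>
      \<Longrightarrow> bracket G x (y + z) = bracket G x y + bracket G x z"
    and bracket_scale_left: "\<lbrakk>x \<in> carrier G; y \<in> carrier G\<rbrakk>
      \<Longrightarrow> bracket G (scale G c x) y = scale G c (bracket G x y)"
    and bracket_scale_right: "\<lbrakk>x \<in> carrier G; y \<in> carrier G\<rbrakk>
      \<Longrightarrow> bracket G x (scale G c y) = scale G c (bracket G x y)"
    and bracket_self: "x \<in> carrier G \<Longrightarrow> bracket G x x = 0"
    and jacobi: "\<lbrakk>x \<in> carrier G; y \<in> carrier G; z \<in> carrier G\<rbrakk>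
      \<Longrightarrow> bracket G x (bracket G y z) + bracket G y (bracket G z x) + bracket G z (bracket G x y) = 0"

definition lin_subspace :: "('k::field, 'a::ab_group_add) lie_alg \<Rightarrow> 'a set \<Rightarrow> bool" where
  "lin_subspace G W \<longleftrightarrow> W \<subseteq> carrier G \<and> module.subspace (scale G) W"

definition lie_subalgebra :: "('k::field, 'a::ab_group_add) lie_alg \<Rightarrow> 'a set \<Rightarrow> bool" where
  "lie_subalgebra G S \<longleftrightarrow> lin_subspace G S \<and> (\<forall>x\<in>S. \<forall>y\<in>S. bracket G x y \<in> S)"

definition lin_map :: "('k::field, 'a::ab_group_add) lie_alg \<Rightarrow> ('k, 'b::ab_group_add) lie_alg
    \<Rightarrow> ('a \<Rightarrow> 'b) \<Rightarrow> bool" where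
  "lin_map G H f \<longleftrightarrow> f ` carrier G \<subseteq> carrier H
     \<and> (\<forall>x\<in>carrier G. \<forall>y\<in>carrier G. f (x + y) = f x + f y)
     \<and> (\<forall>c. \<forall>x\<in>carrier G. f (scale G c x) = scale H c (f x))"

definition lie_iso :: "('k::field, 'a::ab_group_add) lie_alg \<Rightarrow> ('k, 'b::ab_group_add) lie_alg
    \<Rightarrow> ('a \<Rightarrow> 'b) \<Rightarrow> bool" where
  "lie_iso G H f \<longleftrightarrow> lie_algebra G \<and> lie_algebra H \<and> lin_map G H f
     \<and> (\<forall>x\<in>carrier G. \<forall>y\<in>carrier G. f (bracket G x y) = bracket H (f x) (f y))
     \<and> bij_betw f (carrier G) (carrier H)"

definition derivations :: "('k::field, 'a::ab_group_add) lie_alg \<Rightarrow> ('a \<Rightarrow> 'a) set" where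
  "derivations G = {D. lin_map G G D
     \<and> (\<forall>x\<in>carrier G. \<forall>y\<in>carrier G. D (bracket G x y) = bracket G (D x) y + bracket G x (D y))
     \<and> (\<forall>x. x \<notin> carrier G \<longrightarrow> D x = 0)}"

definition Der :: "('k::field, 'a::ab_group_add) lie_alg \<Rightarrow> ('k, 'a \<Rightarrow> 'a) lie_alg" where
  "Der G = \<lparr>carrier = derivations G,
     scale = (\<lambda>c D x. scale G c (D x)),
     bracket = (\<lambda>D E x. D (E x) - E (D x))\<rparr>"

definition centralizer :: "('k::field, 'a::ab_group_add) lie_alg \<Rightarrow> 'a set \<Rightarrow> 'a set" where
  "centralizer G S = {x \<in> carrier G. \<forall>s\<in>S. bracket G x s = 0}"

definition complete_lie_algebra :: "('k::field, 'a::ab_group_add) lie_alg \<Rightarrow> bool" where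
  "complete_lie_algebra G \<longleftrightarrow> lie_algebra G \<and> centralizer G (carrier G) = {0}
     \<and> (\<forall>D\<in>derivations G. \<exists>x\<in>carrier G. \<forall>y\<in>carrier G. D y = bracket G x y)"

text \<open>Semisimple: every invariant subspace has an invariant complement. This does not require the
  operator to be diagonalizable over the ground field.\<close>

definition semisimple :: "('k::field, 'a::ab_group_add) lie_alg \<Rightarrow> ('a \<Rightarrow> 'a) \<Rightarrow> bool" where
  "semisimple G D \<longleftrightarrow> (\<forall>W. lin_subspace G W \<and> D ` W \<subseteq> W \<longrightarrow>
     (\<exists>W'. lin_subspace G W' \<and> D ` W' \<subseteq> W' \<and> W \<inter> W' = {0}
        \<and> {w + w' | w w'. w \<in> W \<and> w' \<in> W'} = carrier G))"

definition torus :: "('k::field, 'a::ab_group_add) lie_alg \<Rightarrow> ('a \<Rightarrow> 'a) set \<Rightarrow> bool" where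
  "torus G B \<longleftrightarrow> lie_subalgebra (Der G) B
     \<and> (\<forall>D\<in>B. \<forall>E\<in>B. bracket (Der G) D E = 0) \<and> (\<forall>D\<in>B. semisimple G D)"

definition dual :: "('k::field, 'a::ab_group_add) lie_alg \<Rightarrow> 'a set \<Rightarrow> ('a \<Rightarrow> 'k) set" where
  "dual G V = {\<alpha>. (\<forall>x\<in>V. \<forall>y\<in>V. \<alpha> (x + y) = \<alpha> x + \<alpha> y)
     \<and> (\<forall>c. \<forall>x\<in>V. \<alpha> (scale G c x) = c * \<alpha> x) \<and> (\<forall>x. x \<notin> V \<longrightarrow> \<alpha> x = 0)}"

definition weight_space :: "('k::field, 'a::ab_group_add) lie_alg \<Rightarrow> ('a \<Rightarrow> 'a) set
    \<Rightarrow> (('a \<Rightarrow> 'a) \<Rightarrow> 'k) \<Rightarrow> 'a set" where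
  "weight_space G B \<alpha> = {x \<in> carrier G. \<forall>D\<in>B. D x = scale G (\<alpha> D) x}"

definition weights :: "('k::field, 'a::ab_group_add) lie_alg \<Rightarrow> ('a \<Rightarrow> 'a) set
    \<Rightarrow> (('a \<Rightarrow> 'a) \<Rightarrow> 'k) set" where
  "weights G B = {\<alpha> \<in> dual (Der G) B. weight_space G B \<alpha> \<noteq> {0}}"

definition is_direct_sum :: "('k::field, 'a::ab_group_add) lie_alg \<Rightarrow> 'i set \<Rightarrow> ('i \<Rightarrow> 'a set) \<Rightarrow> bool" where
  "is_direct_sum G I V \<longleftrightarrow> module.span (scale G) (\<Union>i\<in>I. V i) = carrier G
     \<and> (\<forall>F v. finite F \<and> F \<subseteq> I \<and> (\<forall>i\<in>F. v i \<in> V i) \<and> (\<Sum>i\<in>F. v i) = 0 \<longrightarrow> (\<forall>i\<in>F. v i = 0))"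

definition has_weight_decomposition :: "('k::field, 'a::ab_group_add) lie_alg \<Rightarrow> ('a \<Rightarrow> 'a) set \<Rightarrow> bool" where
  "has_weight_decomposition G B \<longleftrightarrow> is_direct_sum G (weights G B) (weight_space G B)"

definition nondegenerate_pair :: "('k::field, 'a::ab_group_add) lie_alg \<Rightarrow> ('a \<Rightarrow> 'a) set \<Rightarrow> bool" where
  "nondegenerate_pair G B \<longleftrightarrow> (\<forall>\<alpha>\<in>weights G B. \<alpha> \<noteq> 0)"

definition semidirect :: "('a \<Rightarrow> 'a) set \<Rightarrow> ('k::field, 'a::ab_group_add) lie_alg
    \<Rightarrow> ('k, ('a \<Rightarrow> 'a) \<times> 'a) lie_alg" where
  "semidirect S G = \<lparr>carrier = S \<times> carrier G,
     scale = (\<lambda>c (s, g). (scale (Der G) c s, scale G c g)),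
     bracket = (\<lambda>(s1, g1) (s2, g2). (bracket (Der G) s1 s2, s1 g2 - s2 g1 + bracket G g1 g2))\<rparr>"

definition semidirect_der :: "('a \<Rightarrow> 'a) set \<Rightarrow> ('k::field, 'a::ab_group_add) lie_alg
    \<Rightarrow> ('a \<Rightarrow> 'a) \<times> 'a \<Rightarrow> ('a \<Rightarrow> 'a) \<times> 'a \<Rightarrow> ('a \<Rightarrow> 'a) \<times> 'a" where
  "semidirect_der B G = (\<lambda>(t0, g0) (b, g).
     if b \<in> B \<and> g \<in> carrier G then (0, t0 g - b g0 + bracket G g0 g) else 0)"

end

theory Submission
  imports Defs
begin

text \<open>
  Let \<open>S\<close> be a Lie subalgebra with \<open>B \<subseteq> S \<subseteq> \<tau>\<close>. Both halves of the theorem are instances of one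
  statement (\<open>derivation_of_semidirect\<close>): every derivation \<open>D\<close> of \<open>S \<times>\<^sub>t \<gg>\<close> is the restriction of
  \<open>ad u\<close> for some \<open>u\<close> in \<open>\<hh> = \<tau> \<times>\<^sub>t \<gg>\<close>. For \<open>S = B\<close> this is surjectivity of \<open>\<hh> \<rightarrow> Der \<hh>\<^sub>1\<close>, and for
  \<open>S = \<tau>\<close> it says that all derivations of \<open>\<hh>\<close> are inner.

  Since \<open>\<gg>\<close> is finite dimensional, finitely many weight spaces span it. Their weights are nonzero and \<open>K\<close> is
  infinite, so some \<open>b\<^sub>0 \<in> B\<close> is annihilated by none of them and hence acts bijectively on \<open>\<gg>\<close>
  (\<open>regular_element\<close>). This element controls everything.
  Subtracting from \<open>D\<close> the inner derivation of a suitable \<open>(0, g\<^sub>0)\<close> makes the \<open>\<gg>\<close>-component of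
  \<open>D (b\<^sub>0, 0)\<close> vanish. Applying \<open>D\<close> to \<open>[(b\<^sub>0, 0), (0, g)] = (0, b\<^sub>0 g)\<close> and using that \<open>b\<^sub>0\<close> is onto
  shows that \<open>D\<close> preserves \<open>\<gg>\<close>, where it is a derivation \<open>t\<close>. Applying \<open>D\<close> to \<open>[(s, 0), (b\<^sub>0, 0)] = 0\<close> and
  using that \<open>b\<^sub>0\<close> is injective shows that \<open>D\<close> preserves \<open>S\<close>. Then \<open>D (s, 0) = ([t, s], 0)\<close>
  because \<open>D\<close> respects \<open>[(s, 0), (0, g)]\<close>.
  It remains to see that \<open>t\<close> centralizes \<open>B\<close>. For \<open>b \<in> B\<close> the commutator \<open>[t, b]\<close> lies in \<open>S\<close>, so it
  commutes with \<open>b\<close>, and a diagonalizable \<open>b\<close> that commutes with \<open>[t, b]\<close> commutes with \<open>t\<close>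
  (\<open>commuting_commutator_eq_0\<close>). Hence \<open>D = ad (t, g\<^sub>0)\<close>.

  Injectivity of \<open>\<hh> \<rightarrow> Der \<hh>\<^sub>1\<close> and triviality of the center of \<open>\<hh>\<close> also have one source: an element
  \<open>(t, g)\<close> that annihilates \<open>\<hh>\<^sub>1\<close> has \<open>b\<^sub>0 g = 0\<close>, so \<open>g = 0\<close>, and then \<open>t\<close> kills \<open>\<gg>\<close>.

  Both \<open>\<hh>\<close> and \<open>\<hh>\<^sub>1\<close> are subalgebras of the holomorph \<open>Der \<gg> \<times>\<^sub>t \<gg>\<close>, so that the Jacobi identity is
  verified only there, and \<open>\<hh>\<^sub>1\<close> is an ideal of \<open>\<hh>\<close>, so that the map of the theorem is
  the adjoint action of an algebra on an ideal.
\<close>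

section \<open>Linear algebra\<close>

lemma (in vector_space) subspace_of_finite_span:
  assumes "subspace W" "finite S" "W \<subseteq> span S"
  shows "\<exists>T. finite T \<and> span T = W"
proof -
  obtain T where T: "T \<subseteq> W" "independent T" "W \<subseteq> span T"
    by (rule basis_exists)
  have "finite T"
    using independent_span_bound[OF assms(2) T(2) subset_trans[OF T(1) assms(3)]] by simp
  moreover have "span T = W"
    using span_minimal[OF T(1) assms(1)] T(3) by (rule subset_antisym)
  ultimately show ?thesis by blast
qed

text \<open>A vector space over an infinite field is not a finite union of hyperplanes. Given \<open>x\<close> off the
  hyperplanes of \<open>F\<close> and \<open>y\<close> off the hyperplane of \<open>\<alpha>\<close>, each functional vanishes for at
  most one point of the line \<open>x + c y\<close>.\<close>

lemma (in vector_space) avoid_finitely_many_hyperplanes: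
  assumes inf: "infinite (UNIV :: 'a set)"
    and W: "subspace W" and F: "finite F"
    and add: "\<And>\<alpha> x y. \<lbrakk>\<alpha> \<in> F; x \<in> W; y \<in> W\<rbrakk> \<Longrightarrow> \<alpha> (x + y) = \<alpha> x + \<alpha> y"
    and scl: "\<And>\<alpha> c x. \<lbrakk>\<alpha> \<in> F; x \<in> W\<rbrakk> \<Longrightarrow> \<alpha> (scale c x) = c * \<alpha> x"
    and nz: "\<And>\<alpha>. \<alpha> \<in> F \<Longrightarrow> \<exists>x\<in>W. \<alpha> x \<noteq> 0"
  shows "\<exists>x\<in>W. \<forall>\<alpha>\<in>F. \<alpha> x \<noteq> (0::'a)"
  using F add scl nz
proof (induction F rule: finite_induct)
  case empty
  show ?case using subspace_0[OF W] by auto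
next
  case (insert \<alpha> F)
  have "\<exists>x\<in>W. \<forall>\<beta>\<in>F. \<beta> x \<noteq> 0"
    by (rule insert.IH) (rule insert.prems; blast)+
  then obtain x where x: "x \<in> W" "\<And>\<beta>. \<beta> \<in> F \<Longrightarrow> \<beta> x \<noteq> 0"
    by auto
  obtain y where y: "y \<in> W" "\<alpha> y \<noteq> 0"
    using insert.prems(3)[of \<alpha>] by auto
  define bad where "bad = (\<Union>\<beta>\<in>F. {c. \<beta> x + c * \<beta> y = 0}) \<union> {c. \<alpha> x + c * \<alpha> y = 0}"
  have one: "finite {c. u + c * v = (0::'a)}" if "u \<noteq> 0 \<or> v \<noteq> 0" for u v
  proof (rule finite_subset)
    show "{c. u + c * v = 0} \<subseteq> {- u / v}"
    proof
      fix c assume "c \<in> {c. u + c * v = 0}"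
      then have "c * v = - u" "v \<noteq> 0"
        using that by (auto simp: add_eq_0_iff)
      then show "c \<in> {- u / v}" by (metis nonzero_eq_divide_eq singletonI)
    qed
  qed simp
  have "finite bad"
    unfolding bad_def using insert.hyps(1) x(2) y(2) one by simp
  then obtain c where c: "c \<notin> bad"
    using inf ex_new_if_finite by blast
  have lin: "\<beta> (x + scale c y) = \<beta> x + c * \<beta> y" if "\<beta> \<in> insert \<alpha> F" for \<beta>
    using insert.prems(1)[OF that x(1) subspace_scale[OF W y(1)]] insert.prems(2)[OF that y(1)]
    by simp
  have "x + scale c y \<in> W"
    using x(1) y(1) W by (simp add: subspace_add subspace_scale)
  moreover have "\<forall>\<beta>\<in>insert \<alpha> F. \<beta> (x + scale c y) \<noteq> 0"
    using c lin by (auto simp: bad_def)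
  ultimately show ?case by blast
qed

text \<open>Each of the finitely many spanning vectors involves only finitely many of the \<open>V i\<close>. Finiteness
  of the common index set \<open>F\<close> is what leaves only finitely many hyperplanes to avoid.\<close>

lemma (in vector_space) finite_sum_decomposition:
  assumes V: "\<And>i. i \<in> I \<Longrightarrow> subspace (V i)"
    and S: "finite S" "S \<subseteq> span (\<Union>i\<in>I. V i)"
  shows "\<exists>F. finite F \<and> F \<subseteq> I \<and>
    (\<forall>x\<in>span S. \<exists>v. (\<forall>i\<in>F. v i \<in> V i) \<and> x = (\<Sum>i\<in>F. v i))"
proof -
  have "\<exists>F. finite F \<and> F \<subseteq> I \<and> x \<in> span (\<Union>i\<in>F. V i)" if "x \<in> span (\<Union>i\<in>I. V i)" for x
    using that
  proof (induction rule: span_induct_alt)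
    case base
    show ?case by (intro exI[of _ "{}"]) simp
  next
    case (step c x y)
    obtain F where F: "finite F" "F \<subseteq> I" "y \<in> span (\<Union>i\<in>F. V i)"
      using step.IH by auto
    obtain j where j: "j \<in> I" "x \<in> V j"
      using step.hyps by auto
    have "x \<in> span (\<Union>i\<in>insert j F. V i)"
      using j(2) by (intro span_base) simp
    moreover have "y \<in> span (\<Union>i\<in>insert j F. V i)"
      using F(3) span_mono[of "\<Union>i\<in>F. V i" "\<Union>i\<in>insert j F. V i"] by auto
    ultimately have "scale c x + y \<in> span (\<Union>i\<in>insert j F. V i)"
      by (intro span_add span_scale)
    then show ?case
      using F(1,2) j(1) by (intro exI[of _ "insert j F"]) simp
  qed
  then obtain F where F: "\<And>x. x \<in> S \<Longrightarrow> finite (F x) \<and> F x \<subseteq> I \<and> x \<in> span (\<Union>i\<in>F x. V i)"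
    using S(2) by (metis subsetD)
  define F' where "F' = (\<Union>x\<in>S. F x)"
  have F': "finite F'" "F' \<subseteq> I"
    using F S(1) by (auto simp: F'_def)
  define P where "P = {x. \<exists>v. (\<forall>i\<in>F'. v i \<in> V i) \<and> x = (\<Sum>i\<in>F'. v i)}"
  have V': "subspace (V i)" if "i \<in> F'" for i
    using that F'(2) V by auto
  have "subspace P"
  proof (rule subspaceI)
    show "0 \<in> P"
      unfolding P_def using V' subspace_0 by (auto intro!: exI[of _ "\<lambda>_. 0"])
  next
    fix x y assume "x \<in> P" "y \<in> P"
    then obtain v w where "\<forall>i\<in>F'. v i \<in> V i" "x = (\<Sum>i\<in>F'. v i)"
      "\<forall>i\<in>F'. w i \<in> V i" "y = (\<Sum>i\<in>F'. w i)"
      unfolding P_def by auto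
    then show "x + y \<in> P"
      unfolding P_def using V'
      by (auto intro!: exI[of _ "\<lambda>i. v i + w i"] subspace_add simp: sum.distrib)
  next
    fix c x assume "x \<in> P"
    then obtain v where "\<forall>i\<in>F'. v i \<in> V i" "x = (\<Sum>i\<in>F'. v i)"
      unfolding P_def by auto
    then show "scale c x \<in> P"
      unfolding P_def using V'
      by (auto intro!: exI[of _ "\<lambda>i. scale c (v i)"] subspace_scale simp: scale_sum_right)
  qed
  have "V i \<subseteq> P" if i: "i \<in> F'" for i
  proof
    fix x assume "x \<in> V i"
    then show "x \<in> P"
      unfolding P_def using i V' subspace_0 F'(1)
      by (auto intro!: exI[of _ "\<lambda>j. if j = i then x else 0"])
  qed
  then have "span (\<Union>i\<in>F'. V i) \<subseteq> P"
    using \<open>subspace P\<close> by (intro span_minimal) auto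
  moreover have "S \<subseteq> span (\<Union>i\<in>F'. V i)"
  proof
    fix x assume x: "x \<in> S"
    then have "span (\<Union>i\<in>F x. V i) \<subseteq> span (\<Union>i\<in>F'. V i)"
      unfolding F'_def by (intro span_mono) auto
    then show "x \<in> span (\<Union>i\<in>F'. V i)"
      using F[OF x] by auto
  qed
  ultimately have "span S \<subseteq> P"
    using \<open>subspace P\<close> by (intro span_minimal) auto
  then show ?thesis
    using F' unfolding P_def by (intro exI[of _ F']) auto
qed

lemma vector_space_fun:
  assumes "vector_space s"
  shows "vector_space (\<lambda>c f x. s c (f x))"
proof -
  interpret vector_space s by fact
  show ?thesis
    by unfold_locales (auto simp: fun_eq_iff scale_right_distrib scale_left_distrib)
qed

lemma vector_space_prod:
  assumes "vector_space s" "vector_space t"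
  shows "vector_space (\<lambda>c (x, y). (s c x, t c y))"
proof -
  interpret s: vector_space s by fact
  interpret t: vector_space t by fact
  show ?thesis
    by unfold_locales
      (auto simp: s.scale_right_distrib s.scale_left_distrib t.scale_right_distrib t.scale_left_distrib)
qed

lemma sum_fun_apply: "(\<Sum>a\<in>A. f a) x = (\<Sum>a\<in>A. f a x)"
  by (induction A rule: infinite_finite_induct) auto

section \<open>Derivations\<close>

context lie_algebra
begin

lemma carrier_closed [simp]:
  "0 \<in> carrier G"
  "\<lbrakk>x \<in> carrier G; y \<in> carrier G\<rbrakk> \<Longrightarrow> x + y \<in> carrier G"
  "\<lbrakk>x \<in> carrier G; y \<in> carrier G\<rbrakk> \<Longrightarrow> x - y \<in> carrier G"
  "x \<in> carrier G \<Longrightarrow> - x \<in> carrier G"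
  "x \<in> carrier G \<Longrightarrow> scale G c x \<in> carrier G"
  "\<lbrakk>x \<in> carrier G; y \<in> carrier G\<rbrakk> \<Longrightarrow> bracket G x y \<in> carrier G"
  using subspace_carrier
  by (auto intro: subspace_0 subspace_add subspace_diff subspace_neg subspace_scale bracket_closed)

lemma bracket_zero [simp]:
  assumes "x \<in> carrier G"
  shows "bracket G 0 x = 0" "bracket G x 0 = 0"
  using bracket_scale_left[OF assms assms, of 0] bracket_scale_right[OF assms assms, of 0] by simp_all

lemma bracket_diff:
  assumes "x \<in> carrier G" "y \<in> carrier G" "z \<in> carrier G"
  shows "bracket G (x - y) z = bracket G x z - bracket G y z"
    and "bracket G z (x - y) = bracket G z x - bracket G z y"
  using bracket_add_left[of "x - y" y z] bracket_add_right[of z "x - y" y] assms by simp_all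

lemma bracket_anticomm:
  assumes "x \<in> carrier G" "y \<in> carrier G"
  shows "bracket G x y = - bracket G y x"
proof -
  have "bracket G (x + y) (x + y) = bracket G x y + bracket G y x"
    using assms by (simp add: bracket_add_left bracket_add_right bracket_self[OF assms(1)]
        bracket_self[OF assms(2)])
  moreover have "bracket G (x + y) (x + y) = 0"
    by (rule bracket_self) (simp add: assms)
  ultimately show ?thesis
    by (metis eq_neg_iff_add_eq_0)
qed

lemma derivation_in_carrier [simp]: "D \<in> derivations G \<Longrightarrow> D x \<in> carrier G"
  by (cases "x \<in> carrier G") (auto simp: derivations_def lin_map_def)

lemma derivation_outside: "\<lbrakk>D \<in> derivations G; x \<notin> carrier G\<rbrakk> \<Longrightarrow> D x = 0"
  by (simp add: derivations_def)

lemma derivation_add: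
  "\<lbrakk>D \<in> derivations G; x \<in> carrier G; y \<in> carrier G\<rbrakk> \<Longrightarrow> D (x + y) = D x + D y"
  by (simp add: derivations_def lin_map_def)

lemma derivation_scale:
  "\<lbrakk>D \<in> derivations G; x \<in> carrier G\<rbrakk> \<Longrightarrow> D (scale G c x) = scale G c (D x)"
  by (simp add: derivations_def lin_map_def)

lemma derivation_bracket:
  "\<lbrakk>D \<in> derivations G; x \<in> carrier G; y \<in> carrier G\<rbrakk>
    \<Longrightarrow> D (bracket G x y) = bracket G (D x) y + bracket G x (D y)"
  by (simp add: derivations_def)

lemma derivation_zero [simp]: "D \<in> derivations G \<Longrightarrow> D 0 = 0"
  using derivation_add[of D 0 0] by simp

lemma derivation_diff:
  "\<lbrakk>D \<in> derivations G; x \<in> carrier G; y \<in> carrier G\<rbrakk> \<Longrightarrow> D (x - y) = D x - D y"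
  using derivation_add[of D "x - y" y] by simp

lemma derivation_sum:
  assumes "D \<in> derivations G" "finite A" "\<And>a. a \<in> A \<Longrightarrow> f a \<in> carrier G"
  shows "D (\<Sum>a\<in>A. f a) = (\<Sum>a\<in>A. D (f a))"
  using assms(2,3)
proof (induction A rule: finite_induct)
  case (insert a A)
  have "(\<Sum>a\<in>A. f a) \<in> carrier G"
    using insert.prems by (intro subspace_sum subspace_carrier) auto
  then show ?case using insert by (simp add: derivation_add[OF assms(1)])
qed (simp add: assms(1))

lemma derivationI:
  assumes "\<And>x. x \<in> carrier G \<Longrightarrow> D x \<in> carrier G"
    and "\<And>x y. \<lbrakk>x \<in> carrier G; y \<in> carrier G\<rbrakk> \<Longrightarrow> D (x + y) = D x + D y"
    and "\<And>c x. x \<in> carrier G \<Longrightarrow> D (scale G c x) = scale G c (D x)"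
    and "\<And>x y. \<lbrakk>x \<in> carrier G; y \<in> carrier G\<rbrakk>
      \<Longrightarrow> D (bracket G x y) = bracket G (D x) y + bracket G x (D y)"
    and "\<And>x. x \<notin> carrier G \<Longrightarrow> D x = 0"
  shows "D \<in> derivations G"
  using assms by (auto simp: derivations_def lin_map_def)

lemma commutator_derivation:
  assumes "D \<in> derivations G" "E \<in> derivations G"
  shows "(\<lambda>x. D (E x) - E (D x)) \<in> derivations G"
  using assms
  by (intro derivationI)
    (auto simp: derivation_add derivation_scale derivation_bracket derivation_outside
      scale_right_diff_distrib bracket_diff)

lemma Der_simps [simp]:
  "carrier (Der G) = derivations G"
  "scale (Der G) = (\<lambda>c D x. scale G c (D x))"
  "bracket (Der G) = (\<lambda>D E x. D (E x) - E (D x))"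
  by (simp_all add: Der_def)

text \<open>For a basis \<open>A\<close> of the carrier, a derivation is a linear combination of the matrix units
  \<open>x \<mapsto> (a-coordinate of x) b\<close> with \<open>a, b \<in> A\<close>.\<close>

lemma derivations_finite_span:
  "\<exists>T. finite T \<and> derivations G \<subseteq> module.span (scale (Der G)) T"
proof -
  interpret fn: vector_space "\<lambda>c (f :: 'a \<Rightarrow> 'a) x. scale G c (f x)"
    by (rule vector_space_fun) unfold_locales
  obtain S where S: "finite S" "span S = carrier G"
    using finite_dimensional by blast
  obtain A where A: "A \<subseteq> S" "independent A" "S \<subseteq> span A"
    by (rule maximal_independent_subset)
  have fin: "finite A" using A(1) S(1) finite_subset by blast
  have spanA: "span A = carrier G"
    by (metis A(1,3) S(2) span_eq_iff span_mono span_span subset_antisym)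
  \<comment> \<open>Matrix units, cut off outside the carrier because derivations vanish there.\<close>
  define E where "E = (\<lambda>(a, b) x. if x \<in> carrier G then scale G (representation A x a) b else 0)"
  have "D \<in> fn.span (E ` (A \<times> A))" if D: "D \<in> derivations G" for D
  proof -
    have "D = (\<Sum>p\<in>A \<times> A. (\<lambda>x. scale G (representation A (D (fst p)) (snd p)) (E p x)))"
    proof
      fix x
      have "D x = (\<Sum>a\<in>A. \<Sum>b\<in>A. scale G (representation A (D a) b) (scale G (representation A x a) b))"
        if x: "x \<in> carrier G"
      proof -
        have exp: "(\<Sum>b\<in>A. scale G (representation A y b) b) = y" if "y \<in> carrier G" for y
          using sum_representation_eq[OF A(2) _ fin subset_refl, of y] that spanA by simp
        have mem: "a \<in> carrier G" if "a \<in> A" for a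
          using that spanA span_base by blast
        have "D x = D (\<Sum>a\<in>A. scale G (representation A x a) a)"
          by (simp add: exp x)
        also have "\<dots> = (\<Sum>a\<in>A. scale G (representation A x a) (D a))"
          by (simp add: derivation_sum[OF D fin] mem derivation_scale[OF D])
        also have "\<dots> = (\<Sum>a\<in>A. scale G (representation A x a)
            (\<Sum>b\<in>A. scale G (representation A (D a) b) b))"
          by (simp add: exp D)
        finally show ?thesis
          by (simp add: scale_sum_right mult.commute)
      qed
      then show "D x = (\<Sum>p\<in>A \<times> A. (\<lambda>x. scale G (representation A (D (fst p)) (snd p)) (E p x))) x"
        by (cases "x \<in> carrier G")
          (simp_all add: E_def sum_fun_apply sum.cartesian_product case_prod_unfold
            derivation_outside[OF D])
    qed
    also have "\<dots> \<in> fn.span (E ` (A \<times> A))"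
      by (intro fn.span_sum fn.span_scale fn.span_base) auto
    finally show ?thesis .
  qed
  then show ?thesis using fin by (intro exI[of _ "E ` (A \<times> A)"]) auto
qed

lemma lie_algebra_Der: "lie_algebra (Der G)"
proof -
  interpret fn: vector_space "\<lambda>c (f :: 'a \<Rightarrow> 'a) x. scale G c (f x)"
    by (rule vector_space_fun) unfold_locales
  have sub: "fn.subspace (derivations G)"
    by (rule fn.subspaceI)
      (auto intro!: derivationI simp: derivation_add derivation_scale derivation_bracket derivation_outside
        bracket_add_left bracket_add_right bracket_scale_left bracket_scale_right
        scale_right_distrib algebra_simps)
  show ?thesis
  proof (unfold_locales, unfold Der_simps)
    show "\<exists>S. finite S \<and> fn.span S = derivations G"
      using derivations_finite_span fn.subspace_of_finite_span[OF sub] by auto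
  qed (auto simp: sub commutator_derivation fun_eq_iff derivation_add derivation_scale
      derivation_diff scale_right_distrib scale_right_diff_distrib algebra_simps)
qed

end

section \<open>Subalgebras, ideals and semidirect products\<close>

context lie_algebra
begin

lemma lie_algebra_restrict:
  assumes "lie_subalgebra G S"
  shows "lie_algebra (G\<lparr>carrier := S\<rparr>)"
proof -
  have S: "S \<subseteq> carrier G" "subspace S" "\<And>x y. \<lbrakk>x \<in> S; y \<in> S\<rbrakk> \<Longrightarrow> bracket G x y \<in> S"
    using assms by (auto simp: lie_subalgebra_def lin_subspace_def)
  have mem: "x \<in> carrier G" if "x \<in> S" for x
    using that S(1) by blast
  have "\<exists>T. finite T \<and> span T = S"
  proof -
    obtain A where "finite A" "span A = carrier G"
      using finite_dimensional by auto
    then show ?thesis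
      using subspace_of_finite_span[OF S(2)] S(1) by simp
  qed
  then show ?thesis
    by unfold_locales
      (simp_all add: S(2,3) mem scale_right_distrib scale_left_distrib bracket_add_left
        bracket_add_right bracket_scale_left bracket_scale_right bracket_self jacobi)
qed

text \<open>The Jacobi identity in the form that \<open>ad\<close> is a homomorphism.\<close>

lemma jacobi_left:
  assumes "x \<in> carrier G" "y \<in> carrier G" "z \<in> carrier G"
  shows "bracket G (bracket G x y) z = bracket G x (bracket G y z) - bracket G y (bracket G x z)"
proof -
  have "bracket G y (bracket G z x) = - bracket G y (bracket G x z)"
    using assms bracket_diff(2)[of 0 "bracket G x z" y]
    by (simp add: bracket_anticomm[OF assms(3) assms(1)])
  moreover have "bracket G z (bracket G x y) = - bracket G (bracket G x y) z"
    by (rule bracket_anticomm) (simp_all add: assms)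
  ultimately show ?thesis
    using jacobi[OF assms] by (simp add: algebra_simps)
qed

lemma lie_subalgebra_centralizer:
  assumes "S \<subseteq> carrier G"
  shows "lie_subalgebra G (centralizer G S)"
proof -
  have mem: "s \<in> carrier G" if "s \<in> S" for s
    using that assms by blast
  show ?thesis
    unfolding lie_subalgebra_def lin_subspace_def centralizer_def
    by (auto intro!: subspaceI simp: mem bracket_add_left bracket_scale_left jacobi_left)
qed

lemma ad_derivation:
  assumes I: "lie_subalgebra G I" "\<And>x y. \<lbrakk>x \<in> carrier G; y \<in> I\<rbrakk> \<Longrightarrow> bracket G x y \<in> I"
    and x: "x \<in> carrier G"
  shows "(\<lambda>y. if y \<in> I then bracket G x y else 0) \<in> derivations (G\<lparr>carrier := I\<rparr>)"
proof -
  interpret I: lie_algebra "G\<lparr>carrier := I\<rparr>"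
    by (rule lie_algebra_restrict[OF I(1)])
  have mem: "y \<in> carrier G" if "y \<in> I" for y
    using that I(1) by (auto simp: lie_subalgebra_def lin_subspace_def)
  show ?thesis
    using I.carrier_closed I(2)
    by (intro I.derivationI)
      (auto simp: mem x bracket_add_right bracket_scale_right jacobi_left)
qed

text \<open>By the Jacobi identity, \<open>ad\<close> is a homomorphism into the derivations of an ideal. The last two
  hypotheses are injectivity and surjectivity. The map \<open>f\<close> is prescribed only on
  the carrier, where it is to be compared with a map given by another formula.\<close>

lemma ad_lie_iso:
  assumes I: "lie_subalgebra G I" "\<And>x y. \<lbrakk>x \<in> carrier G; y \<in> I\<rbrakk> \<Longrightarrow> bracket G x y \<in> I"
    and f: "\<And>x. x \<in> carrier G \<Longrightarrow> f x = (\<lambda>y. if y \<in> I then bracket G x y else 0)"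
    and faithful: "\<And>x. \<lbrakk>x \<in> carrier G; \<And>y. y \<in> I \<Longrightarrow> bracket G x y = 0\<rbrakk> \<Longrightarrow> x = 0"
    and inner: "\<And>D. D \<in> derivations (G\<lparr>carrier := I\<rparr>)
      \<Longrightarrow> \<exists>x\<in>carrier G. \<forall>y\<in>I. D y = bracket G x y"
  shows "lie_iso G (Der (G\<lparr>carrier := I\<rparr>)) f"
proof -
  interpret I: lie_algebra "G\<lparr>carrier := I\<rparr>"
    by (rule lie_algebra_restrict[OF I(1)])
  have mem: "y \<in> carrier G" if "y \<in> I" for y
    using that I(1) by (auto simp: lie_subalgebra_def lin_subspace_def)
  have der: "f x \<in> derivations (G\<lparr>carrier := I\<rparr>)" if "x \<in> carrier G" for x
    using ad_derivation[OF I that] f[OF that] by simp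
  have lin: "lin_map G (Der (G\<lparr>carrier := I\<rparr>)) f"
    unfolding lin_map_def
  proof (intro conjI ballI allI)
    show "f ` carrier G \<subseteq> carrier (Der (G\<lparr>carrier := I\<rparr>))"
      using der by auto
    show "f (x + y) = f x + f y" if "x \<in> carrier G" "y \<in> carrier G" for x y
      using that by (simp add: f mem fun_eq_iff bracket_add_left)
    show "f (scale G c x) = scale (Der (G\<lparr>carrier := I\<rparr>)) c (f x)" if "x \<in> carrier G" for c x
      using that by (simp add: f mem fun_eq_iff bracket_scale_left)
  qed
  have hom: "f (bracket G x y) = bracket (Der (G\<lparr>carrier := I\<rparr>)) (f x) (f y)"
    if "x \<in> carrier G" "y \<in> carrier G" for x y
    using that I.carrier_closed(1) by (simp add: f mem I(2) fun_eq_iff jacobi_left)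
  have inj: "inj_on f (carrier G)"
  proof (rule inj_onI)
    fix x y assume xy: "x \<in> carrier G" "y \<in> carrier G" "f x = f y"
    have eq: "bracket G x z = bracket G y z" if "z \<in> I" for z
      using fun_cong[OF xy(3), of z] that by (simp add: f xy(1,2))
    have "x - y = 0"
      by (rule faithful) (simp_all add: xy(1,2) eq bracket_diff mem)
    then show "x = y" by simp
  qed
  have surj: "derivations (G\<lparr>carrier := I\<rparr>) \<subseteq> f ` carrier G"
  proof
    fix D assume D: "D \<in> derivations (G\<lparr>carrier := I\<rparr>)"
    then obtain x where x: "x \<in> carrier G" "\<And>y. y \<in> I \<Longrightarrow> D y = bracket G x y"
      using inner by meson
    then have "D = f x"
      using I.derivation_outside[OF D] by (simp add: f fun_eq_iff)
    then show "D \<in> f ` carrier G" using x(1) by simp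
  qed
  have "bij_betw f (carrier G) (carrier (Der (G\<lparr>carrier := I\<rparr>)))"
    using inj surj der by (auto simp: bij_betw_def)
  then show ?thesis
    unfolding lie_iso_def using lin hom lie_algebra_axioms I.lie_algebra_Der by blast
qed

end

lemma prod_finite_span:
  assumes "vector_space s" "vector_space t" "finite S" "finite T"
  shows "\<exists>U. finite U \<and>
    module.span s S \<times> module.span t T \<subseteq> module.span (\<lambda>c (x, y). (s c x, t c y)) U"
proof -
  interpret s: vector_space s by fact
  interpret t: vector_space t by fact
  interpret p: vector_space "\<lambda>c (x, y). (s c x, t c y)"
    using assms(1,2) by (rule vector_space_prod)
  define U where "U = (\<lambda>x. (x, 0)) ` S \<union> Pair 0 ` T"
  have "(x, 0) \<in> p.span U" if "x \<in> s.span S" for x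
    using that
  proof (induction rule: s.span_induct_alt)
    case base
    then show ?case using p.span_zero[of U] by (simp add: zero_prod_def)
  next
    case (step c z w)
    have "(z, 0) \<in> p.span U"
      using step.hyps by (intro p.span_base) (simp add: U_def)
    then show ?case
      using p.span_add[OF p.span_scale[of "(z, 0)" U c] step.IH] by simp
  qed
  moreover have "(0, y) \<in> p.span U" if "y \<in> t.span T" for y
    using that
  proof (induction rule: t.span_induct_alt)
    case base
    then show ?case using p.span_zero[of U] by (simp add: zero_prod_def)
  next
    case (step c z w)
    have "(0, z) \<in> p.span U"
      using step.hyps by (intro p.span_base) (simp add: U_def)
    then show ?case
      using p.span_add[OF p.span_scale[of "(0, z)" U c] step.IH] by simp
  qed
  ultimately have "(x, y) \<in> p.span U" if "x \<in> s.span S" "y \<in> t.span T" for x y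
    using p.span_add[of "(x, 0)" U "(0, y)"] that by simp
  moreover have "finite U"
    using assms(3,4) by (simp add: U_def)
  ultimately show ?thesis by (intro exI[of _ U]) auto
qed

context lie_algebra
begin

lemma semidirect_simps [simp]:
  "carrier (semidirect S G) = S \<times> carrier G"
  "scale (semidirect S G) = (\<lambda>c (s, g). ((\<lambda>x. scale G c (s x)), scale G c g))"
  "bracket (semidirect S G) (s, g) (s', g') =
    ((\<lambda>x. s (s' x) - s' (s x)), s g' - s' g + bracket G g g')"
  by (simp_all add: semidirect_def)

lemma semidirect_restrict: "(semidirect S G)\<lparr>carrier := S' \<times> carrier G\<rparr> = semidirect S' G"
  by (simp add: semidirect_def)

text \<open>In the \<open>\<gg>\<close>-component of the cyclic Jacobi sum the terms \<open>a (b z)\<close> cancel against those from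
  \<open>[a, b] z\<close>, the terms \<open>a [y, z]\<close> cancel against the mixed brackets because \<open>a\<close> is a derivation, and what is left is
  the Jacobi identity of \<open>\<gg>\<close>.\<close>

lemma lie_algebra_holomorph: "lie_algebra (semidirect (derivations G) G)"
proof -
  interpret Der: lie_algebra "Der G" by (rule lie_algebra_Der)
  interpret p: vector_space "\<lambda>c (s :: 'a \<Rightarrow> 'a, g). ((\<lambda>x. scale G c (s x)), scale G c g)"
    using vector_space_prod[OF Der.vector_space_axioms vector_space_axioms] by simp
  have sub: "p.subspace (derivations G \<times> carrier G)"
    using Der.carrier_closed(1,2,5) by (intro p.subspaceI) (auto simp: zero_prod_def)
  obtain S T where S: "finite S" "Der.span S = derivations G" and T: "finite T" "span T = carrier G"
    using finite_dimensional Der.finite_dimensional by auto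
  have fin: "\<exists>U. finite U \<and> p.span U = derivations G \<times> carrier G"
    using prod_finite_span[OF Der.vector_space_axioms vector_space_axioms S(1) T(1)]
      p.subspace_of_finite_span[OF sub] S(2) T(2) by auto
  have closed: "(\<lambda>x. D (E x) - E (D x)) \<in> derivations G"
    if "D \<in> derivations G" "E \<in> derivations G" for D E
    using that by (rule commutator_derivation)
  have jac: "bracket H u (bracket H v w) + bracket H v (bracket H w u) + bracket H w (bracket H u v) = 0"
    if uvw: "u \<in> derivations G \<times> carrier G" "v \<in> derivations G \<times> carrier G"
      "w \<in> derivations G \<times> carrier G" and H: "H = semidirect (derivations G) G" for u v w H
  proof -
    obtain a x b y c z where eq: "u = (a, x)" "v = (b, y)" "w = (c, z)"
      and d: "a \<in> derivations G" "b \<in> derivations G" "c \<in> derivations G"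
      and e: "x \<in> carrier G" "y \<in> carrier G" "z \<in> carrier G"
      using uvw by blast
    \<comment> \<open>The mixed brackets are oriented with the derivation on the left, so that they cancel.\<close>
    have "bracket G y (a z) = - bracket G (a z) y" "bracket G z (a y) = - bracket G (a y) z"
      "bracket G x (b z) = - bracket G (b z) x" "bracket G z (b x) = - bracket G (b x) z"
      "bracket G x (c y) = - bracket G (c y) x" "bracket G y (c x) = - bracket G (c x) y"
      using d e by (simp_all add: bracket_anticomm[of x] bracket_anticomm[of y] bracket_anticomm[of z])
    then show ?thesis
      using jacobi[OF e]
      by (simp add: eq H d e zero_prod_def fun_eq_iff derivation_add derivation_diff derivation_bracket
          bracket_add_right bracket_diff algebra_simps)
  qed
  show ?thesis
  proof (unfold_locales, unfold semidirect_simps(1,2))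
    show "p.subspace (derivations G \<times> carrier G)" by (rule sub)
    show "\<exists>U. finite U \<and> p.span U = derivations G \<times> carrier G" by (rule fin)
  next
    fix u v w
    assume "u \<in> derivations G \<times> carrier G" "v \<in> derivations G \<times> carrier G"
      "w \<in> derivations G \<times> carrier G"
    then show "bracket (semidirect (derivations G) G) u (bracket (semidirect (derivations G) G) v w) +
        bracket (semidirect (derivations G) G) v (bracket (semidirect (derivations G) G) w u) +
        bracket (semidirect (derivations G) G) w (bracket (semidirect (derivations G) G) u v) = 0"
      by (rule jac) (rule refl)
  qed (auto simp: closed p.scale_right_distrib p.scale_left_distrib zero_prod_def fun_eq_iff
      derivation_add derivation_diff derivation_scale bracket_add_left bracket_add_right
      bracket_scale_left bracket_scale_right bracket_self scale_right_distrib
      scale_right_diff_distrib algebra_simps)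
qed

lemma lie_subalgebra_semidirect:
  assumes S: "lie_subalgebra (Der G) S" and T: "lie_subalgebra (Der G) T" "S \<subseteq> T"
  shows "lie_subalgebra (semidirect T G) (S \<times> carrier G)"
proof -
  interpret Der: lie_algebra "Der G" by (rule lie_algebra_Der)
  interpret p: vector_space "\<lambda>c (s :: 'a \<Rightarrow> 'a, g). ((\<lambda>x. scale G c (s x)), scale G c g)"
    using vector_space_prod[OF Der.vector_space_axioms vector_space_axioms] by simp
  have sub: "Der.subspace S" "S \<subseteq> derivations G"
    "\<And>s t. \<lbrakk>s \<in> S; t \<in> S\<rbrakk> \<Longrightarrow> (\<lambda>x. s (t x) - t (s x)) \<in> S"
    using S by (auto simp: lie_subalgebra_def lin_subspace_def)
  have "p.subspace (S \<times> carrier G)"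
    using Der.subspace_0[OF sub(1)] Der.subspace_add[OF sub(1)] Der.subspace_scale[OF sub(1)]
    by (intro p.subspaceI) (auto simp: zero_prod_def)
  moreover have "s x \<in> carrier G" if "s \<in> S" for s x
    using that sub(2) by auto
  ultimately show ?thesis
    using T(2) sub(3) by (auto simp: lie_subalgebra_def lin_subspace_def)
qed

lemma lie_algebra_semidirect:
  assumes "lie_subalgebra (Der G) S"
  shows "lie_algebra (semidirect S G)"
proof -
  interpret Der: lie_algebra "Der G" by (rule lie_algebra_Der)
  interpret H: lie_algebra "semidirect (derivations G) G" by (rule lie_algebra_holomorph)
  have "lie_subalgebra (Der G) (derivations G)"
    using Der.subspace_carrier by (auto simp: lie_subalgebra_def lin_subspace_def commutator_derivation)
  moreover have "S \<subseteq> derivations G"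
    using assms by (simp add: lie_subalgebra_def lin_subspace_def)
  ultimately show ?thesis
    using H.lie_algebra_restrict lie_subalgebra_semidirect[OF assms] by (metis semidirect_restrict)
qed

end

section \<open>Non-degenerate tori\<close>

locale nondegenerate_torus = lie_algebra G
  for G :: "('k::field_char_0, 'a::ab_group_add) lie_alg" +
  fixes B :: "('a \<Rightarrow> 'a) set"
  assumes torus: "torus G B"
    and decomposition: "has_weight_decomposition G B"
    and nondegenerate: "nondegenerate_pair G B"
begin

sublocale Der: lie_algebra "Der G"
  by (rule lie_algebra_Der)

abbreviation \<tau> :: "('a \<Rightarrow> 'a) set" where
  "\<tau> \<equiv> centralizer (Der G) B"

lemma subalgebra_B: "lie_subalgebra (Der G) B"
  using torus by (simp add: torus_def)

lemma B_derivation [simp]: "b \<in> B \<Longrightarrow> b \<in> derivations G"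
  using subalgebra_B by (auto simp: lie_subalgebra_def lin_subspace_def)

lemma subalgebra_\<tau>: "lie_subalgebra (Der G) \<tau>"
  by (rule Der.lie_subalgebra_centralizer) auto

lemma \<tau>_iff: "t \<in> \<tau> \<longleftrightarrow> t \<in> derivations G \<and> (\<forall>b\<in>B. \<forall>x. t (b x) = b (t x))"
  by (auto simp: centralizer_def fun_eq_iff)

lemma B_subset_\<tau>: "B \<subseteq> \<tau>"
  using torus by (auto simp: torus_def centralizer_def)

lemma subspace_weight_space: "subspace (weight_space G B \<alpha>)"
  by (rule subspaceI)
    (auto simp: weight_space_def derivation_add derivation_scale scale_right_distrib mult.commute)

lemma finite_weight_decomposition:
  "\<exists>F. finite F \<and> F \<subseteq> weights G B \<and>
    (\<forall>x\<in>carrier G. \<exists>v. (\<forall>\<alpha>\<in>F. v \<alpha> \<in> weight_space G B \<alpha>) \<and> x = (\<Sum>\<alpha>\<in>F. v \<alpha>))"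
proof -
  obtain S where S: "finite S" "span S = carrier G"
    using finite_dimensional by auto
  have "S \<subseteq> span (\<Union>\<alpha>\<in>weights G B. weight_space G B \<alpha>)"
    using decomposition S(2) span_superset[of S]
    by (simp add: has_weight_decomposition_def is_direct_sum_def)
  from finite_sum_decomposition[OF subspace_weight_space S(1) this]
  show ?thesis unfolding S(2) by simp
qed

lemma weight_spaces_independent:
  assumes "finite F" "F \<subseteq> weights G B" "\<And>\<alpha>. \<alpha> \<in> F \<Longrightarrow> v \<alpha> \<in> weight_space G B \<alpha>"
    and "(\<Sum>\<alpha>\<in>F. v \<alpha>) = 0" and "\<alpha> \<in> F"
  shows "v \<alpha> = 0"
  using assms decomposition unfolding has_weight_decomposition_def is_direct_sum_def by metis

lemma weight_space_apply:
  "\<lbrakk>x \<in> weight_space G B \<alpha>; b \<in> B\<rbrakk> \<Longrightarrow> b x = scale G (\<alpha> b) x"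
  by (simp add: weight_space_def)

lemma weight_space_carrier: "x \<in> weight_space G B \<alpha> \<Longrightarrow> x \<in> carrier G"
  by (simp add: weight_space_def)

lemma apply_sum_of_weight_vectors:
  assumes "b \<in> B" "finite F" "\<And>\<alpha>. \<alpha> \<in> F \<Longrightarrow> v \<alpha> \<in> weight_space G B \<alpha>"
  shows "b (\<Sum>\<alpha>\<in>F. v \<alpha>) = (\<Sum>\<alpha>\<in>F. scale G (\<alpha> b) (v \<alpha>))"
proof -
  have "b (\<Sum>\<alpha>\<in>F. v \<alpha>) = (\<Sum>\<alpha>\<in>F. b (v \<alpha>))"
    using assms(1,2) weight_space_carrier[OF assms(3)] by (intro derivation_sum) simp_all
  then show ?thesis
    using weight_space_apply[OF assms(3) assms(1)] by simp
qed

text \<open>On the spanning weight spaces \<open>b\<close> acts by the scalars \<open>\<alpha> b\<close>, so \<open>b\<close> is bijective as soon as it avoids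
  the hyperplanes \<open>\<alpha> = 0\<close>. This is where non-degeneracy enters.\<close>

lemma regular_element:
  "\<exists>b\<in>B. (\<forall>x\<in>carrier G. b x = 0 \<longrightarrow> x = 0) \<and> (\<forall>y\<in>carrier G. \<exists>x\<in>carrier G. b x = y)"
proof -
  obtain F where F: "finite F" "F \<subseteq> weights G B"
    and dec: "\<And>x. x \<in> carrier G
      \<Longrightarrow> \<exists>v. (\<forall>\<alpha>\<in>F. v \<alpha> \<in> weight_space G B \<alpha>) \<and> x = (\<Sum>\<alpha>\<in>F. v \<alpha>)"
    using finite_weight_decomposition by auto
  have dual: "\<alpha> \<in> dual (Der G) B" if "\<alpha> \<in> F" for \<alpha>
    using that F(2) by (auto simp: weights_def)
  have "\<exists>b\<in>B. \<forall>\<alpha>\<in>F. \<alpha> b \<noteq> 0"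
  proof (rule Der.avoid_finitely_many_hyperplanes)
    show "infinite (UNIV :: 'k set)" by (rule infinite_UNIV_char_0)
    show "Der.subspace B"
      using subalgebra_B by (simp add: lie_subalgebra_def lin_subspace_def)
    show "finite F" by (rule F(1))
    show "\<alpha> (x + y) = \<alpha> x + \<alpha> y" if "\<alpha> \<in> F" "x \<in> B" "y \<in> B" for \<alpha> x y
      using dual[OF that(1)] that(2,3) by (simp add: dual_def)
    show "\<alpha> (scale (Der G) c x) = c * \<alpha> x" if "\<alpha> \<in> F" "x \<in> B" for \<alpha> c x
      using dual[OF that(1)] that(2) by (simp add: dual_def)
    show "\<exists>b\<in>B. \<alpha> b \<noteq> 0" if "\<alpha> \<in> F" for \<alpha>
    proof (rule ccontr)
      assume "\<not> (\<exists>b\<in>B. \<alpha> b \<noteq> 0)"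
      then have "\<alpha> b = 0" for b
        using dual[OF that] by (cases "b \<in> B") (auto simp: dual_def)
      then have "\<alpha> = 0" by (simp add: fun_eq_iff)
      then show False
        using nondegenerate that F(2) by (auto simp: nondegenerate_pair_def)
    qed
  qed
  then obtain b where b: "b \<in> B" "\<And>\<alpha>. \<alpha> \<in> F \<Longrightarrow> \<alpha> b \<noteq> 0"
    by auto
  have sum: "b (\<Sum>\<alpha>\<in>F. v \<alpha>) = (\<Sum>\<alpha>\<in>F. scale G (\<alpha> b) (v \<alpha>))"
    if v: "\<And>\<alpha>. \<alpha> \<in> F \<Longrightarrow> v \<alpha> \<in> weight_space G B \<alpha>" for v
    using b(1) F(1) v by (rule apply_sum_of_weight_vectors)
  show ?thesis
  proof (intro bexI[OF _ b(1)] conjI ballI impI)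
    show "x = 0" if x: "x \<in> carrier G" and bx: "b x = 0" for x
    proof -
      obtain v where v: "\<And>\<alpha>. \<alpha> \<in> F \<Longrightarrow> v \<alpha> \<in> weight_space G B \<alpha>" "x = (\<Sum>\<alpha>\<in>F. v \<alpha>)"
        using dec[OF x] by auto
      have "scale G (\<alpha> b) (v \<alpha>) = 0" if "\<alpha> \<in> F" for \<alpha>
        using F _ _ that
      proof (rule weight_spaces_independent)
        show "(\<Sum>\<alpha>\<in>F. scale G (\<alpha> b) (v \<alpha>)) = 0"
          using bx sum[OF v(1)] v(2) by simp
      qed (simp add: v(1) subspace_scale[OF subspace_weight_space])
      then show "x = 0"
        using v(2) b(2) by simp
    qed
    show "\<exists>x\<in>carrier G. b x = y" if y: "y \<in> carrier G" for y
    proof -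
      obtain v where v: "\<And>\<alpha>. \<alpha> \<in> F \<Longrightarrow> v \<alpha> \<in> weight_space G B \<alpha>" "y = (\<Sum>\<alpha>\<in>F. v \<alpha>)"
        using dec[OF y] by auto
      define w where "w \<alpha> = scale G (inverse (\<alpha> b)) (v \<alpha>)" for \<alpha>
      have w: "w \<alpha> \<in> weight_space G B \<alpha>" if "\<alpha> \<in> F" for \<alpha>
        using v(1)[OF that] by (simp add: w_def subspace_scale[OF subspace_weight_space])
      have "b (\<Sum>\<alpha>\<in>F. w \<alpha>) = y"
        using sum[OF w] b(2) by (simp add: v(2) w_def)
      moreover have "(\<Sum>\<alpha>\<in>F. w \<alpha>) \<in> carrier G"
        using weight_space_carrier[OF w] by (intro subspace_sum subspace_carrier) simp
      ultimately show ?thesis by (rule rev_bexI[rotated])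
    qed
  qed
qed

text \<open>\<open>b - c\<close> acts on the \<open>\<alpha>\<close>-component of \<open>y\<close> by a scalar. If its square kills that component, so does
  \<open>b - c\<close> itself.\<close>

lemma no_generalized_eigenvectors:
  assumes b: "b \<in> B" and y: "y \<in> carrier G"
    and z: "z = b y - scale G c y" "b z = scale G c z"
  shows "z = 0"
proof -
  obtain F where F: "finite F" "F \<subseteq> weights G B"
    and dec: "\<And>x. x \<in> carrier G
      \<Longrightarrow> \<exists>v. (\<forall>\<alpha>\<in>F. v \<alpha> \<in> weight_space G B \<alpha>) \<and> x = (\<Sum>\<alpha>\<in>F. v \<alpha>)"
    using finite_weight_decomposition by auto
  obtain v where v: "\<And>\<alpha>. \<alpha> \<in> F \<Longrightarrow> v \<alpha> \<in> weight_space G B \<alpha>" "y = (\<Sum>\<alpha>\<in>F. v \<alpha>)"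
    using dec[OF y] by auto
  have step: "b (\<Sum>\<alpha>\<in>F. w \<alpha>) - scale G c (\<Sum>\<alpha>\<in>F. w \<alpha>) = (\<Sum>\<alpha>\<in>F. scale G (\<alpha> b - c) (w \<alpha>))"
    if w: "\<And>\<alpha>. \<alpha> \<in> F \<Longrightarrow> w \<alpha> \<in> weight_space G B \<alpha>" for w
    using apply_sum_of_weight_vectors[OF b F(1) w]
    by (simp add: scale_sum_right sum_subtractf scale_left_diff_distrib)
  have scl: "scale G d x \<in> weight_space G B \<alpha>" if "x \<in> weight_space G B \<alpha>" for d x \<alpha>
    using that by (rule subspace_scale[OF subspace_weight_space])
  have z1: "z = (\<Sum>\<alpha>\<in>F. scale G (\<alpha> b - c) (v \<alpha>))"
    using step[of v] v by (simp add: z(1))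
  have "b z - scale G c z = (\<Sum>\<alpha>\<in>F. scale G (\<alpha> b - c) (scale G (\<alpha> b - c) (v \<alpha>)))"
    unfolding z1 by (rule step) (simp add: v(1) scl)
  then have sum0: "(\<Sum>\<alpha>\<in>F. scale G (\<alpha> b - c) (scale G (\<alpha> b - c) (v \<alpha>))) = 0"
    by (simp add: z(2))
  have "scale G (\<alpha> b - c) (scale G (\<alpha> b - c) (v \<alpha>)) = 0" if \<alpha>: "\<alpha> \<in> F" for \<alpha>
    by (rule weight_spaces_independent[OF F _ sum0 \<alpha>]) (rule scl, rule scl, rule v(1))
  then show ?thesis
    unfolding z1 by (intro sum.neutral) auto
qed

text \<open>On a weight vector \<open>w\<close> of weight \<open>\<alpha>\<close> the commutator \<open>c = [t, b]\<close> satisfies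
  \<open>c w = - (b - \<alpha> b) (t w)\<close>. Since \<open>c\<close> commutes with \<open>b\<close>, the vector \<open>c w\<close> is again
  an eigenvector for \<open>\<alpha> b\<close>, which makes \<open>t w\<close> a generalized eigenvector, hence an eigenvector.\<close>

lemma commuting_commutator_eq_0:
  assumes b: "b \<in> B" and t: "t \<in> derivations G"
    and comm: "\<And>x. t (b x) - b (t x) = c x" "\<And>x. c (b x) = b (c x)"
  shows "c x = 0"
proof (cases "x \<in> carrier G")
  case x: True
  have wt: "c w = 0" if w: "w \<in> weight_space G B \<alpha>" for w \<alpha>
  proof -
    have w': "w \<in> carrier G" using w by (rule weight_space_carrier)
    have c: "c w = - (b (t w) - scale G (\<alpha> b) (t w))"
      using comm(1)[of w] by (simp add: weight_space_apply[OF w b] derivation_scale[OF t w'])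
    have "b (c w) = scale G (\<alpha> b) (c w)"
    proof -
      have "b (c w) = c (scale G (\<alpha> b) w)"
        by (simp add: comm(2)[symmetric] weight_space_apply[OF w b])
      also have "\<dots> = scale G (\<alpha> b) (c w)"
        using w' t b by (simp add: comm(1)[symmetric] derivation_scale scale_right_diff_distrib)
      finally show ?thesis .
    qed
    moreover have "c w \<in> carrier G"
      using t b by (simp add: comm(1)[symmetric])
    ultimately have "b (- c w) = scale G (\<alpha> b) (- c w)"
      using derivation_diff[of b 0 "c w"] b by simp
    then have "- c w = 0"
      by (rule no_generalized_eigenvectors[OF b, of "t w", rotated 2]) (simp_all add: c t)
    then show ?thesis by simp
  qed
  obtain F v where F: "finite F" "\<And>\<alpha>. \<alpha> \<in> F \<Longrightarrow> v \<alpha> \<in> weight_space G B \<alpha>"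
    and xv: "x = (\<Sum>\<alpha>\<in>F. v \<alpha>)"
    using finite_weight_decomposition x by meson
  have "c x = (\<Sum>\<alpha>\<in>F. c (v \<alpha>))"
    using F t b weight_space_carrier[OF F(2)]
    by (simp add: comm(1)[symmetric] xv derivation_sum sum_subtractf)
  also have "\<dots> = 0"
    using wt[OF F(2)] by (intro sum.neutral) simp
  finally show ?thesis .
next
  case False
  then show ?thesis
    using t b by (simp add: comm(1)[symmetric] derivation_outside)
qed

section \<open>Derivations of semidirect products\<close>

text \<open>The common core of both claims, with \<open>S\<close> ranging between \<open>B\<close> and \<open>\<tau>\<close>: \<open>B \<subseteq> S\<close> provides the regular
  element, and \<open>S \<subseteq> \<tau>\<close> makes commutators of \<open>S\<close> with \<open>B\<close> vanish.\<close>

lemma derivation_of_semidirect: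
  assumes S: "lie_subalgebra (Der G) S" "B \<subseteq> S" "S \<subseteq> \<tau>"
    and D: "D \<in> derivations (semidirect S G)"
  shows "\<exists>u\<in>\<tau> \<times> carrier G. \<forall>v\<in>S \<times> carrier G. D v = bracket (semidirect \<tau> G) u v"
proof -
  interpret H: lie_algebra "semidirect S G"
    by (rule lie_algebra_semidirect[OF S(1)])
  interpret DerH: lie_algebra "Der (semidirect S G)"
    by (rule H.lie_algebra_Der)
  have S\<tau>: "s \<in> \<tau>" if "s \<in> S" for s
    using that S(3) by auto
  have Sder [simp]: "s \<in> derivations G" if "s \<in> S" for s
    using S\<tau>[OF that] by (simp add: \<tau>_iff)
  have Scomm: "s (b x) = b (s x)" if "s \<in> S" "b \<in> B" for s b x
    using S\<tau>[OF that(1)] that(2) by (simp add: \<tau>_iff)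
  have S0 [simp]: "0 \<in> S"
    using H.carrier_closed(1) by (simp add: zero_prod_def)
  obtain b0 where b0: "b0 \<in> B"
    and inj: "\<And>x. \<lbrakk>x \<in> carrier G; b0 x = 0\<rbrakk> \<Longrightarrow> x = 0"
    and surj: "\<And>y. y \<in> carrier G \<Longrightarrow> \<exists>x\<in>carrier G. b0 x = y"
    using regular_element by auto
  have b0S [simp]: "b0 \<in> S" using b0 S(2) by auto
  have D_in: "fst (D v) \<in> S" "snd (D v) \<in> carrier G" for v
    using H.derivation_in_carrier[OF D, of v] by (auto simp: mem_Times_iff)
  \<comment> \<open>The \<open>\<gg>\<close>-component of \<open>[(0, g0), (b0, 0)]\<close> is \<open>- b0 g0\<close>, which is to equal that of \<open>D (b0, 0)\<close>.\<close>
  obtain g0 where g0: "g0 \<in> carrier G" "b0 g0 = - snd (D (b0, 0))"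
    using surj[of "- snd (D (b0, 0))"] D_in(2) by auto

  \<comment> \<open>Without this inner part, \<open>D\<close> becomes a derivation \<open>E\<close> that sends \<open>(b0, 0)\<close> into \<open>S\<close>.\<close>
  define A where "A = (\<lambda>v. if v \<in> S \<times> carrier G then bracket (semidirect S G) (0, g0) v else 0)"
  have A: "A \<in> derivations (semidirect S G)"
  proof -
    have "lie_subalgebra (semidirect S G) (S \<times> carrier G)"
      using S(1) by (intro lie_subalgebra_semidirect) auto
    moreover have "bracket (semidirect S G) x y \<in> S \<times> carrier G"
      if "x \<in> carrier (semidirect S G)" "y \<in> S \<times> carrier G" for x y
      using H.bracket_closed[OF that(1), of y] that(2) by simp
    ultimately have "A \<in> derivations ((semidirect S G)\<lparr>carrier := S \<times> carrier G\<rparr>)"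
      unfolding A_def by (rule H.ad_derivation) (simp_all add: g0(1))
    then show ?thesis by (simp only: semidirect_restrict)
  qed
  define E where "E = D - A"
  have E: "E \<in> derivations (semidirect S G)"
    using DerH.carrier_closed(3)[of D A] D A by (simp add: E_def)
  have E_in: "fst (E v) \<in> S" "snd (E v) \<in> carrier G" for v
    using H.derivation_in_carrier[OF E, of v] by (auto simp: mem_Times_iff)
  have E_bracket: "E (bracket (semidirect S G) (s, g) (s', g')) =
      bracket (semidirect S G) (E (s, g)) (s', g') + bracket (semidirect S G) (s, g) (E (s', g'))"
    if "s \<in> S" "s' \<in> S" "g \<in> carrier G" "g' \<in> carrier G" for s s' g g'
    using that by (intro H.derivation_bracket[OF E]) auto

  define c where "c s = fst (E (s, 0))" for s
  define t where "t g = snd (E (0, g))" for g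
  have c_in [simp]: "c s \<in> S" for s
    unfolding c_def by (rule E_in)
  have t_in [simp]: "t g \<in> carrier G" for g
    unfolding t_def by (rule E_in)
  have Eb0: "E (b0, 0) = (c b0, 0)"
    using g0 b0 by (auto simp: prod_eq_iff c_def E_def A_def)
  \<comment> \<open>\<open>\<gg>\<close> is preserved: write \<open>(0, g) = [(b0, 0), (0, g')]\<close>.\<close>
  have E0: "E (0, g) = (0, t g)" if g: "g \<in> carrier G" for g
  proof -
    obtain g' where g': "g' \<in> carrier G" "b0 g' = g"
      using surj[OF g] by auto
    obtain s x where sx: "E (0, g') = (s, x)" "s \<in> S"
      using E_in[of "(0, g')"] by (cases "E (0, g')") simp
    have "E (0, g) = bracket (semidirect S G) (c b0, 0) (0, g') + bracket (semidirect S G) (b0, 0) (s, x)"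
      using E_bracket[of b0 0 0 g'] g' b0 by (simp add: Eb0 sx(1) zero_fun_def[symmetric])
    then have "fst (E (0, g)) = 0"
      using sx(2) b0 by (simp add: fun_eq_iff Scomm)
    then show ?thesis by (simp add: prod_eq_iff t_def)
  qed
  \<comment> \<open>\<open>S\<close> is preserved: apply \<open>E\<close> to \<open>[(s, 0), (b0, 0)] = 0\<close>, whose \<open>\<gg>\<close>-component becomes \<open>- b0 x\<close>.\<close>
  have Es: "E (s, 0) = (c s, 0)" if s: "s \<in> S" for s
  proof -
    obtain x where x: "E (s, 0) = (c s, x)" "x \<in> carrier G"
      using E_in(2)[of "(s, 0)"] by (cases "E (s, 0)") (simp add: c_def)
    have "bracket (semidirect S G) (s, 0) (b0, 0) = 0"
      using s b0 by (simp add: Scomm zero_prod_def fun_eq_iff)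
    then have "0 = bracket (semidirect S G) (c s, x) (b0, 0) + bracket (semidirect S G) (s, 0) (c b0, 0)"
      using E_bracket[of s b0 0 0] s by (simp add: Eb0 x(1) H.derivation_zero[OF E])
    then have "b0 x = 0"
      using s x(2) by (simp add: zero_prod_def)
    then show ?thesis
      using inj x by simp
  qed
  have Esg: "E (s, g) = (c s, t g)" if "s \<in> S" "g \<in> carrier G" for s g
    using H.derivation_add[OF E, of "(s, 0)" "(0, g)"] that by (simp add: Es E0)
  have t: "t \<in> derivations G"
  proof (rule derivationI)
    show "t x \<in> carrier G" for x by simp
    show "t (x + y) = t x + t y" if "x \<in> carrier G" "y \<in> carrier G" for x y
      using H.derivation_add[OF E, of "(0, x)" "(0, y)"] that by (simp add: E0)
    show "t (scale G a x) = scale G a (t x)" if "x \<in> carrier G" for a x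
      using H.derivation_scale[OF E, of "(0, x)" a] that
      by (simp add: E0 zero_fun_def[symmetric])
    show "t (bracket G x y) = bracket G (t x) y + bracket G x (t y)"
      if "x \<in> carrier G" "y \<in> carrier G" for x y
      using E_bracket[of 0 0 x y] that by (simp add: E0 zero_fun_def[symmetric])
    show "t x = 0" if "x \<notin> carrier G" for x
      using H.derivation_outside[OF E, of "(0, x)"] that by (simp add: t_def)
  qed
  have ct: "t (s x) - s (t x) = c s x" if s: "s \<in> S" for s x
  proof (cases "x \<in> carrier G")
    case True
    then show ?thesis
      using E_bracket[of s 0 0 x] s by (simp add: Es E0 zero_fun_def[symmetric] algebra_simps)
  next
    case False
    then show ?thesis
      using s t by (simp add: derivation_outside)
  qed
  have cb: "c b x = 0" if b: "b \<in> B" for b x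
    using b t ct Scomm[OF c_in b]
    by (rule commuting_commutator_eq_0) (use b S(2) in auto)
  have "t (b x) = b (t x)" if "b \<in> B" for b x
    using ct[of b x] cb[of b x] that S(2) by auto
  then have "t \<in> \<tau>"
    using t by (simp add: \<tau>_iff)
  moreover have "D (s, g) = bracket (semidirect \<tau> G) (t, g0) (s, g)"
    if "s \<in> S" "g \<in> carrier G" for s g
  proof -
    have "D (s, g) = E (s, g) + A (s, g)" by (simp add: E_def)
    also have "\<dots> = bracket (semidirect \<tau> G) (t, g0) (s, g)"
      using that by (auto simp: Esg A_def ct fun_eq_iff)
    finally show ?thesis .
  qed
  ultimately show ?thesis
    using g0(1) by (intro bexI[of _ "(t, g0)"]) auto
qed

text \<open>Bracketing with \<open>(b, 0)\<close> for a regular \<open>b\<close> forces the \<open>\<gg>\<close>-component to vanish, and bracketing with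
  \<open>\<gg>\<close> then forces the \<open>\<tau>\<close>-component to vanish. Annihilating \<open>B \<times> \<gg>\<close> rather than all of \<open>\<hh>\<close> suffices,
  so this gives both the trivial center and the injectivity of \<open>\<hh> \<rightarrow> Der \<hh>\<^sub>1\<close>.\<close>

lemma semidirect_faithful:
  assumes u: "u \<in> \<tau> \<times> carrier G"
    and zero: "\<And>v. v \<in> B \<times> carrier G \<Longrightarrow> bracket (semidirect \<tau> G) u v = 0"
  shows "u = 0"
proof -
  obtain t g where tg: "u = (t, g)" "t \<in> \<tau>" "g \<in> carrier G"
    using u by auto
  have t: "t \<in> derivations G" using tg(2) by (simp add: \<tau>_iff)
  obtain b where b: "b \<in> B" and inj: "\<And>x. \<lbrakk>x \<in> carrier G; b x = 0\<rbrakk> \<Longrightarrow> x = 0"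
    using regular_element by auto
  have "b g = 0"
    using zero[of "(b, 0)"] b t tg(3) by (simp add: tg(1) zero_prod_def)
  then have g: "g = 0"
    using inj tg(3) by simp
  have "t x = 0" for x
  proof (cases "x \<in> carrier G")
    case True
    have "b 0 = 0" using b by simp
    then show ?thesis
      using zero[of "(b, x)"] True b by (simp add: tg(1) g zero_prod_def)
  qed (simp add: derivation_outside[OF t])
  then show ?thesis
    by (simp add: tg(1) g zero_prod_def fun_eq_iff)
qed

sublocale \<hh>: lie_algebra "semidirect \<tau> G"
  by (rule lie_algebra_semidirect[OF subalgebra_\<tau>])

text \<open>\<open>\<hh>\<^sub>1\<close> is an ideal of \<open>\<hh>\<close> with \<open>[\<hh>, \<hh>\<^sub>1] \<subseteq> 0 \<times> \<gg>\<close>, because \<open>\<tau>\<close> centralizes \<open>B\<close>. This is also why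
  the \<open>B\<close>-component in the definition of \<open>semidirect_der\<close> is zero.\<close>

lemma lie_iso_Der: "lie_iso (semidirect \<tau> G) (Der (semidirect B G)) (semidirect_der B G)"
proof -
  have B0: "0 \<in> B"
    using subalgebra_B Der.subspace_0 by (simp add: lie_subalgebra_def lin_subspace_def)
  have "lie_iso (semidirect \<tau> G) (Der ((semidirect \<tau> G)\<lparr>carrier := B \<times> carrier G\<rparr>))
      (semidirect_der B G)"
  proof (rule \<hh>.ad_lie_iso)
    show "lie_subalgebra (semidirect \<tau> G) (B \<times> carrier G)"
      by (rule lie_subalgebra_semidirect[OF subalgebra_B subalgebra_\<tau> B_subset_\<tau>])
    show "bracket (semidirect \<tau> G) u v \<in> B \<times> carrier G"
      if "u \<in> carrier (semidirect \<tau> G)" "v \<in> B \<times> carrier G" for u v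
      using that B0 by (auto simp: \<tau>_iff zero_fun_def)
    show "semidirect_der B G u =
        (\<lambda>v. if v \<in> B \<times> carrier G then bracket (semidirect \<tau> G) u v else 0)"
      if "u \<in> carrier (semidirect \<tau> G)" for u
      using that by (auto simp: semidirect_der_def fun_eq_iff \<tau>_iff)
    show "u = 0" if "u \<in> carrier (semidirect \<tau> G)"
      "\<And>v. v \<in> B \<times> carrier G \<Longrightarrow> bracket (semidirect \<tau> G) u v = 0" for u
      by (rule semidirect_faithful) (use that in simp_all)
    show "\<exists>u\<in>carrier (semidirect \<tau> G). \<forall>v\<in>B \<times> carrier G. D v = bracket (semidirect \<tau> G) u v"
      if "D \<in> derivations ((semidirect \<tau> G)\<lparr>carrier := B \<times> carrier G\<rparr>)" for D
      using derivation_of_semidirect[OF subalgebra_B subset_refl B_subset_\<tau>, of D] that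
      by (simp only: semidirect_restrict semidirect_simps(1))
  qed
  then show ?thesis by (simp only: semidirect_restrict)
qed

lemma complete_semidirect: "complete_lie_algebra (semidirect \<tau> G)"
  unfolding complete_lie_algebra_def
proof (intro conjI ballI)
  show "lie_algebra (semidirect \<tau> G)"
    by (rule \<hh>.lie_algebra_axioms)
  show "centralizer (semidirect \<tau> G) (carrier (semidirect \<tau> G)) = {0}"
  proof (intro subset_antisym subsetI)
    fix u assume "u \<in> centralizer (semidirect \<tau> G) (carrier (semidirect \<tau> G))"
    then have u: "u \<in> carrier (semidirect \<tau> G)"
      "\<And>v. v \<in> carrier (semidirect \<tau> G) \<Longrightarrow> bracket (semidirect \<tau> G) u v = 0"
      unfolding centralizer_def[of "semidirect \<tau> G"] by blast+
    have "u = 0"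
    proof (rule semidirect_faithful)
      show "u \<in> \<tau> \<times> carrier G" using u(1) by simp
      show "bracket (semidirect \<tau> G) u v = 0" if "v \<in> B \<times> carrier G" for v
        by (rule u(2)) (use that B_subset_\<tau> in auto)
    qed
    then show "u \<in> {0}" by simp
  next
    fix u :: "('a \<Rightarrow> 'a) \<times> 'a"
    assume "u \<in> {0}"
    then show "u \<in> centralizer (semidirect \<tau> G) (carrier (semidirect \<tau> G))"
      unfolding centralizer_def[of "semidirect \<tau> G"]
      using \<hh>.carrier_closed(1) \<hh>.bracket_zero(1) by blast
  qed
  fix D assume "D \<in> derivations (semidirect \<tau> G)"
  from derivation_of_semidirect[OF subalgebra_\<tau> B_subset_\<tau> subset_refl this]
  show "\<exists>u\<in>carrier (semidirect \<tau> G). \<forall>v\<in>carrier (semidirect \<tau> G). D v = bracket (semidirect \<tau> G) u v"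
    by (simp only: semidirect_simps(1))
qed

end

theorem theorem1:
  fixes G :: "('k::field_char_0, 'a::ab_group_add) lie_alg" and B :: "('a \<Rightarrow> 'a) set"
  assumes "lie_algebra G"
    and "torus G B"
    and "has_weight_decomposition G B"
    and "nondegenerate_pair G B"
  shows "let \<tau> = centralizer (Der G) B; \<hh> = semidirect \<tau> G; \<hh>\<^sub>1 = semidirect B G in
    lie_iso \<hh> (Der \<hh>\<^sub>1) (semidirect_der B G) \<and> complete_lie_algebra \<hh>"
proof -
  interpret nondegenerate_torus G B
    using assms by (simp add: nondegenerate_torus_def nondegenerate_torus_axioms_def)
  show ?thesis
    using lie_iso_Der complete_semidirect by (simp add: Let_def)
qed

end
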